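(* If $0\leq\varepsilon\leq\pi/6$ and $n\geq 3$ is an integer, then $F_2(\varepsilon,n)\leq 2n-4$.
   Context: A Steiner topology for $n$ terminals is a (graph-theoretic) tree $\mathcal{T}$ with $n$ special vertices $t_1,\dots,t_n$, called terminals, all of degree at most $3$, and all other vertices, called Steiner points, of degree exactly $3$. It is full if all terminals have degree $1$. Given a family $p_1,\dots,p_n$ of points in $\mathbb{R}^d$ (repetitions allowed), a Steiner tree with topology $\mathcal{T}$ on these points is a representation of $\mathcal{T}$ in $\mathbb{R}^d$ in which $t_i$ is represented by $p_i$, each Steiner point by an arbitrary point of $\mathbb{R}^d$, and each edge by a straight-line segment; points may coincide (so edges may have length $0$; such edges, and trees containing them, are called degenerate) and edges may cross. The length $L(T)$ is the sum of the Euclidean lengths of the edges. Angles are measured in $[0,\pi]$. For $\varepsilon\geq 0$, an $\varepsilon$-approximate Steiner tree is a tree with a Steiner topology such that at each Steiner point all three angles spanned by pairs of incident edges belong to $[2\pi/3-\varepsilon,2\pi/3+\varepsilon]$ (in particular these angles are defined, so edges at Steiner points have positive length). $\mathcal{A}_\varepsilon^d(n)$ denotes the set of all $\varepsilon$-approximate Steiner trees in $\mathbb{R}^d$ with full Steiner topology on $n$ terminals. For a tree $T$ in $\mathbb{R}^d$ with Steiner topology $\mathcal{T}$, $S(T)$ denotes the (unique) shortest tree in $\mathbb{R}^d$ on the terminals of $T$ with topology $\mathcal{T}$, where degenerate trees are allowed. Define \[F_d(\varepsilon,n)=\sup\left\{\frac{L(T)-L(S(T))}{L(S(T))}: T\in\mathcal{A}_\varepsilon^d(n)\right\}.\]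 *)

theory Defs
  imports "HOL-Analysis.Analysis"
begin

text \<open>
  Graphs are finite, simple and undirected, given by a vertex set \<open>V\<close> and a set \<open>E\<close> of
  two-element subsets of \<open>V\<close>.  Vertices are natural numbers: every finite graph has an isomorphic
  copy of this form, and all quantities below are invariant under isomorphism.
\<close>

definition simple_graph :: "nat set \<Rightarrow> nat set set \<Rightarrow> bool" where
  "simple_graph V E \<longleftrightarrow> finite V \<and> (\<forall>e\<in>E. e \<subseteq> V \<and> card e = 2)"

definition connected_graph :: "nat set \<Rightarrow> nat set set \<Rightarrow> bool" where
  "connected_graph V E \<longleftrightarrow> V \<noteq> {} \<and> (\<forall>u\<in>V. \<forall>v\<in>V. (u, v) \<in> {(a, b). {a, b} \<in> E}\<^sup>*)"

definition graph_cycle :: "nat set set \<Rightarrow> nat list \<Rightarrow> bool" where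
  "graph_cycle E c \<longleftrightarrow> 3 \<le> length c \<and> distinct c \<and>
     (\<forall>i<length c. {c ! i, c ! (Suc i mod length c)} \<in> E)"

definition graph_tree :: "nat set \<Rightarrow> nat set set \<Rightarrow> bool" where
  "graph_tree V E \<longleftrightarrow> simple_graph V E \<and> connected_graph V E \<and> (\<nexists>c. graph_cycle E c)"

definition degree :: "nat set set \<Rightarrow> nat \<Rightarrow> nat" where
  "degree E v = card {e\<in>E. v \<in> e}"

text \<open>
  A topology for \<open>n\<close> terminals is a triple \<open>V\<close>, \<open>E\<close>, \<open>t\<close>, where \<open>t 1, \<dots>, t n\<close> are the terminals;
  the values of \<open>t\<close> outside \<open>{1..n}\<close> are irrelevant.
\<close>

definition steiner_points :: "nat \<Rightarrow> nat set \<Rightarrow> (nat \<Rightarrow> nat) \<Rightarrow> nat set" where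
  "steiner_points n V t = V - t ` {1..n}"

definition steiner_topology :: "nat \<Rightarrow> nat set \<Rightarrow> nat set set \<Rightarrow> (nat \<Rightarrow> nat) \<Rightarrow> bool" where
  "steiner_topology n V E t \<longleftrightarrow>
     graph_tree V E \<and> inj_on t {1..n} \<and> t ` {1..n} \<subseteq> V \<and>
     (\<forall>i\<in>{1..n}. degree E (t i) \<le> 3) \<and> (\<forall>s\<in>steiner_points n V t. degree E s = 3)"

definition full_steiner_topology :: "nat \<Rightarrow> nat set \<Rightarrow> nat set set \<Rightarrow> (nat \<Rightarrow> nat) \<Rightarrow> bool" where
  "full_steiner_topology n V E t \<longleftrightarrow>
     steiner_topology n V E t \<and> (\<forall>i\<in>{1..n}. degree E (t i) = 1)"

text \<open>
  A tree in \<open>\<real>\<^sup>d\<close> with topology \<open>V\<close>, \<open>E\<close>, \<open>t\<close> is given by an arbitrary placement \<open>x\<close> of the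
  vertices (its values outside \<open>V\<close> are irrelevant), and \<open>x (t i)\<close> is the point \<open>p\<^sub>i\<close>.  The segment
  representing the edge \<open>e = {u, v}\<close> has length \<open>diameter {x u, x v} = dist (x u) (x v)\<close>.
\<close>

definition edge_length :: "(nat \<Rightarrow> real ^ 'd) \<Rightarrow> nat set \<Rightarrow> real" where
  "edge_length x e = diameter (x ` e)"

lemma edge_length_doubleton: "edge_length x {u, v} = dist (x u) (x v)"
proof -
  have "diameter {x u, x v} \<le> dist (x u) (x v)"
    by (rule diameter_le) (auto simp: dist_norm norm_minus_commute)
  moreover have "dist (x u) (x v) \<le> diameter {x u, x v}"
    by (rule diameter_bounded_bound) auto
  ultimately show ?thesis by (simp add: edge_length_def)
qed

definition tree_length :: "nat set set \<Rightarrow> (nat \<Rightarrow> real ^ 'd) \<Rightarrow> real" where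
  "tree_length E x = (\<Sum>e\<in>E. edge_length x e)"

text \<open>The angle in \<open>[0, \<pi>]\<close> between two vectors; only meaningful if both are nonzero.\<close>

definition vec_angle :: "real ^ 'd \<Rightarrow> real ^ 'd \<Rightarrow> real" where
  "vec_angle a b = arccos (a \<bullet> b / (norm a * norm b))"

definition approx_steiner ::
  "real \<Rightarrow> nat \<Rightarrow> nat set \<Rightarrow> nat set set \<Rightarrow> (nat \<Rightarrow> nat) \<Rightarrow> (nat \<Rightarrow> real ^ 'd) \<Rightarrow> bool" where
  "approx_steiner \<epsilon> n V E t x \<longleftrightarrow>
     steiner_topology n V E t \<and>
     (\<forall>s\<in>steiner_points n V t.
        (\<forall>u. {s, u} \<in> E \<longrightarrow> x u \<noteq> x s) \<and>
        (\<forall>u v. {s, u} \<in> E \<and> {s, v} \<in> E \<and> u \<noteq> v \<longrightarrow>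
           vec_angle (x u - x s) (x v - x s) \<in> {2 * pi / 3 - \<epsilon> .. 2 * pi / 3 + \<epsilon>}))"

text \<open>The set \<open>\<A>\<^sub>\<epsilon>\<^sup>d(n)\<close>.\<close>

definition approx_full_steiner_trees ::
  "real \<Rightarrow> nat \<Rightarrow> (nat set \<times> nat set set \<times> (nat \<Rightarrow> nat) \<times> (nat \<Rightarrow> real ^ 'd)) set" where
  "approx_full_steiner_trees \<epsilon> n =
     {(V, E, t, x). full_steiner_topology n V E t \<and> approx_steiner \<epsilon> n V E t x}"

text \<open>
  \<open>S(T)\<close>: a length-minimising placement with the same topology and the same terminals, degenerate
  placements being allowed.  Only its length is used, and this does not depend on which minimiser
  is selected.
\<close>

definition shortest_tree ::
  "nat \<Rightarrow> nat set set \<Rightarrow> (nat \<Rightarrow> nat) \<Rightarrow> (nat \<Rightarrow> real ^ 'd) \<Rightarrow> (nat \<Rightarrow> real ^ 'd)" where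
  "shortest_tree n E t x = arg_min (tree_length E) (\<lambda>y. \<forall>i\<in>{1..n}. y (t i) = x (t i))"

text \<open>
  The supremum is taken in the extended reals, so no boundedness is presupposed.  The division is
  the one of \<^typ>\<open>ereal\<close>, where \<open>a / 0 = \<infinity>\<close> for \<open>a > 0\<close>: a tree of positive length with
  \<open>L(S(T)) = 0\<close> would make the supremum infinite.
\<close>

definition steiner_F :: "'d::finite itself \<Rightarrow> real \<Rightarrow> nat \<Rightarrow> ereal" where
  "steiner_F d \<epsilon> n =
     (SUP (V, E, t, x :: nat \<Rightarrow> real ^ 'd) \<in> approx_full_steiner_trees \<epsilon> n.
        ereal (tree_length E x - tree_length E (shortest_tree n E t x)) /
        ereal (tree_length E (shortest_tree n E t x)))"

end

theory Submission
  imports Defs "HOL-Library.Transitive_Closure_Table"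
begin

text \<open>
  Let \<open>T\<close> be an \<open>\<epsilon>\<close>-approximate Steiner tree in the plane with a full topology.  As \<open>\<epsilon> \<le> \<pi>/6\<close>,
  all angles at its Steiner points are at least \<open>\<pi>/2\<close>.  The claim is
  \<open>L(T) \<le> (2n - 3) L(S(T))\<close>.  A full topology has at most \<open>2n - 3\<close> edges
  (\<open>card_edges_full_steiner_topology\<close>), so it suffices that every single edge of \<open>T\<close> has length at most \<open>L(S(T))\<close>.

  Let \<open>d\<close> be the vector from one end of an edge of \<open>T\<close> to the other.  Three nonzero
  vectors in the plane with pairwise angles at least \<open>\<pi>/2\<close> do not fit into a half-plane unless two
  of them lie on its boundary (\<open>obtuse_triple_half_plane\<close>).  Hence a walk along \<open>T\<close> that arrives at
  a Steiner point without going backwards in the direction \<open>d\<close> can leave it by another edge, again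
  without going backwards.  Since the tree is finite and acyclic, the walk ends, and it can only end
  at a terminal (\<open>ex_terminal_ahead\<close>).  Walking from the edge in both directions gives two
  terminals whose difference has an inner product with \<open>d\<close> of at least \<open>d \<bullet> d\<close>, so that their
  distance is at least the length of the edge (\<open>ex_distant_terminals\<close>).  Any tree with the same
  topology on the same terminals joins these two terminals, so it is at least as long as the edge.

  To apply this to \<open>S(T)\<close>, a shortest tree must exist (\<open>ex_shortest_placement\<close>).  A tree with a
  vertex at a distance of more than \<open>L(T)\<close> from a terminal is longer than \<open>T\<close> and can be
  disregarded, which leaves a compact set of placements to minimise over.
\<close>

section \<open>Finite acyclic graphs\<close>

lemma edge_ends:
  assumes "simple_graph V E" "{u, v} \<in> E"
  shows "u \<noteq> v" "u \<in> V" "v \<in> V"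
  using assms by (auto simp: simple_graph_def)

lemma simple_graph_finite_edges:
  assumes "simple_graph V E"
  shows "finite E"
proof -
  have "E \<subseteq> Pow V" using assms by (auto simp: simple_graph_def)
  then show ?thesis using assms by (meson finite_Pow_iff finite_subset simple_graph_def)
qed

lemma degree_eq_card_neighbours:
  assumes "simple_graph V E"
  shows "degree E v = card {u. {v, u} \<in> E}"
proof -
  have "bij_betw (\<lambda>u. {v, u}) {u. {v, u} \<in> E} {e\<in>E. v \<in> e}"
  proof (rule bij_betw_imageI)
    show "inj_on (\<lambda>u. {v, u}) {u. {v, u} \<in> E}"
      by (auto simp: inj_on_def doubleton_eq_iff)
    show "(\<lambda>u. {v, u}) ` {u. {v, u} \<in> E} = {e\<in>E. v \<in> e}"
    proof
      show "{e\<in>E. v \<in> e} \<subseteq> (\<lambda>u. {v, u}) ` {u. {v, u} \<in> E}"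
      proof
        fix e assume e: "e \<in> {e\<in>E. v \<in> e}"
        then have "card e = 2" using assms by (auto simp: simple_graph_def)
        then obtain a b where "e = {a, b}" by (auto simp: card_2_iff)
        with e show "e \<in> (\<lambda>u. {v, u}) ` {u. {v, u} \<in> E}"
          by (auto simp: insert_commute)
      qed
    qed auto
  qed
  then show ?thesis by (simp add: degree_def bij_betw_same_card)
qed

lemma sum_degree:
  assumes "simple_graph V E"
  shows "(\<Sum>v\<in>V. degree E v) = 2 * card E"
  unfolding degree_def
proof (rule sum_multicount)
  show "finite V" using assms by (simp add: simple_graph_def)
  show "finite E" using assms by (rule simple_graph_finite_edges)
  show "\<forall>e\<in>E. card {v\<in>V. v \<in> e} = 2"
  proof
    fix e assume "e \<in> E"
    then have "e \<subseteq> V" "card e = 2" using assms by (auto simp: simple_graph_def)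
    moreover from this have "{v\<in>V. v \<in> e} = e" by auto
    ultimately show "card {v\<in>V. v \<in> e} = 2" by simp
  qed
qed

text \<open>
  A walk that never turns back immediately visits no vertex twice: two visits to one vertex at the
  smallest possible time difference would enclose a cycle.
\<close>

lemma inj_nonbacktracking_walk:
  fixes f :: "nat \<Rightarrow> nat"
  assumes G: "simple_graph V E" and acyc: "\<nexists>c. graph_cycle E c"
    and walk: "\<And>i. {f i, f (Suc i)} \<in> E"
    and nb: "\<And>i. f (Suc (Suc i)) \<noteq> f i"
  shows "inj f"
proof (rule ccontr)
  assume "\<not> inj f"
  then obtain a b where "f a = f b" "a \<noteq> b" by (auto simp: inj_on_def)
  then have "\<exists>k i. 0 < k \<and> f (i + k) = f i"
  proof (induction a b rule: linorder_wlog)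
    case (le a b)
    then show ?case by (intro exI[of _ "b - a"] exI[of _ a]) auto
  next
    case (sym a b)
    then show ?case by metis
  qed
  then obtain k where k: "\<exists>i. 0 < k \<and> f (i + k) = f i"
    and least: "\<And>l. l < k \<Longrightarrow> \<not> (\<exists>i. 0 < l \<and> f (i + l) = f i)"
    using exists_least_iff[of "\<lambda>k. \<exists>i. 0 < k \<and> f (i + k) = f i"] by auto
  from k obtain i where i: "0 < k" "f (i + k) = f i" by auto
  have "k \<noteq> 1" using i edge_ends(1)[OF G walk[of i]] by auto
  moreover have "k \<noteq> 2" using i nb[of i] by auto
  ultimately have k3: "3 \<le> k" using i(1) by linarith
  let ?c = "map f [i..<i + k]"
  have neq: "f p \<noteq> f q" if "i \<le> p" "p < q" "q < i + k" for p q
  proof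
    assume "f p = f q"
    then have "f (p + (q - p)) = f p" using that by simp
    moreover have "q - p < k" "0 < q - p" using that by auto
    ultimately show False using least by blast
  qed
  have "distinct ?c"
    unfolding distinct_map
  proof
    show "inj_on f (set [i..<i + k])"
    proof (rule inj_onI)
      fix p q assume "p \<in> set [i..<i + k]" "q \<in> set [i..<i + k]" "f p = f q"
      then show "p = q" using neq[of p q] neq[of q p] by (cases p q rule: linorder_cases) auto
    qed
  qed simp
  moreover have "{?c ! j, ?c ! (Suc j mod length ?c)} \<in> E" if "j < length ?c" for j
  proof (cases "Suc j < k")
    case True
    then show ?thesis using walk[of "i + j"] by simp
  next
    case False
    with that have "Suc j = k" by simp
    then show ?thesis using walk[of "i + j"] i by (simp add: add_Suc_right[symmetric] del: add_Suc_right)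
  qed
  ultimately have "graph_cycle E ?c" using k3 by (simp add: graph_cycle_def)
  with acyc show False by blast
qed

text \<open>
  A set \<open>D\<close> of directed edges in which each one can be continued, without turning back, would
  contain an endless walk that never turns back.
\<close>

lemma no_endless_continuation:
  assumes G: "simple_graph V E" and acyc: "\<nexists>c. graph_cycle E c"
    and edges: "\<And>u v. (u, v) \<in> D \<Longrightarrow> {u, v} \<in> E"
    and cont: "\<And>u v. (u, v) \<in> D \<Longrightarrow> \<exists>w. w \<noteq> u \<and> (v, w) \<in> D"
  shows "D = {}"
proof (rule ccontr)
  assume "D \<noteq> {}"
  then have "\<exists>p. p \<in> D" by blast
  moreover have "\<exists>q. q \<in> D \<and> fst q = snd p \<and> snd q \<noteq> fst p" if "p \<in> D" for p
    using cont[of "fst p" "snd p"] that by fastforce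
  ultimately obtain g where g: "\<And>i. g i \<in> D"
    and next_edge: "\<And>i. fst (g (Suc i)) = snd (g i) \<and> snd (g (Suc i)) \<noteq> fst (g i)"
    using dependent_nat_choice[of "\<lambda>_ p. p \<in> D" "\<lambda>_ p q. fst q = snd p \<and> snd q \<noteq> fst p"]
    by blast
  define f where "f i = fst (g i)" for i
  have walk: "{f i, f (Suc i)} \<in> E" for i
    using edges[of "fst (g i)" "snd (g i)"] g[of i] next_edge[of i] by (simp add: f_def)
  have "f (Suc (Suc i)) \<noteq> f i" for i
    using next_edge[of i] next_edge[of "Suc i"] by (simp add: f_def)
  with G acyc walk have "inj f" by (rule inj_nonbacktracking_walk)
  moreover have "range f \<subseteq> V" using edge_ends(2)[OF G walk] by blast
  ultimately have "infinite V" using finite_subset range_inj_infinite by blast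
  with G show False by (simp add: simple_graph_def)
qed

lemma ex_degree_le_1:
  assumes G: "simple_graph V E" and acyc: "\<nexists>c. graph_cycle E c" and "V \<noteq> {}"
  shows "\<exists>v\<in>V. degree E v \<le> 1"
proof (rule ccontr)
  assume "\<not> ?thesis"
  then have deg: "2 \<le> card {u. {v, u} \<in> E}" if "v \<in> V" for v
    using that degree_eq_card_neighbours[OF G, of v] by force
  have other: "\<exists>w. w \<noteq> u \<and> {v, w} \<in> E" if "v \<in> V" for u v
  proof (rule ccontr)
    assume "\<not> ?thesis"
    then have "{w. {v, w} \<in> E} \<subseteq> {u}" by auto
    from card_mono[OF _ this] deg[OF that] show False by simp
  qed
  have "{(u, v). {u, v} \<in> E} = {}"
  proof (rule no_endless_continuation[OF G acyc])
    fix u v assume "(u, v) \<in> {(u, v). {u, v} \<in> E}"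
    then show "\<exists>w. w \<noteq> u \<and> (v, w) \<in> {(u, v). {u, v} \<in> E}"
      using other[of v u] edge_ends(3)[OF G, of u v] by auto
  qed auto
  with other \<open>V \<noteq> {}\<close> show False by blast
qed

lemma card_edges_acyclic:
  assumes "simple_graph V E" "\<nexists>c. graph_cycle E c" "V \<noteq> {}"
  shows "card E < card V"
  using assms
proof (induction "card V" arbitrary: V E rule: less_induct)
  case less
  note G = less.prems(1)
  have finV: "finite V" using G by (simp add: simple_graph_def)
  have finE: "finite E" using G by (rule simple_graph_finite_edges)
  obtain v where v: "v \<in> V" "degree E v \<le> 1" using ex_degree_le_1[OF less.prems] by blast
  define E' where "E' = {e\<in>E. v \<notin> e}"
  have "E = E' \<union> {e\<in>E. v \<in> e}" by (auto simp: E'_def)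
  then have "card E \<le> card E' + degree E v"
    using card_Un_le[of E' "{e\<in>E. v \<in> e}"] by (simp add: degree_def)
  then have le: "card E \<le> card E' + 1" using v(2) by linarith
  have G': "simple_graph (V - {v}) E'"
    using G by (auto simp: simple_graph_def E'_def)
  have acyc': "\<nexists>c. graph_cycle E' c"
    using less.prems(2) by (auto simp: graph_cycle_def E'_def)
  have cardV: "card V = Suc (card (V - {v}))" using finV v(1) by (rule card.remove)
  show ?case
  proof (cases "V - {v} = {}")
    case True
    then have "V = {v}" using v(1) by auto
    have "E = {}"
    proof (rule ccontr)
      assume "E \<noteq> {}"
      then obtain e where "e \<subseteq> {v}" "card e = 2"
        using G \<open>V = {v}\<close> by (auto simp: simple_graph_def)
      then show False using card_mono[of "{v}" e] by simp
    qed
    then show ?thesis using \<open>V = {v}\<close> by simp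
  next
    case False
    have "card E' < card (V - {v})"
      by (rule less.hyps[OF _ G' acyc' False]) (simp add: cardV)
    then show ?thesis using le cardV by linarith
  qed
qed

lemma card_edges_full_steiner_topology:
  assumes T: "full_steiner_topology n V E t" and n: "1 \<le> n"
  shows "card E + 3 \<le> 2 * n"
proof -
  let ?A = "t ` {1..n}"
  have G: "simple_graph V E" and acyc: "\<nexists>c. graph_cycle E c" and "V \<noteq> {}"
    and inj: "inj_on t {1..n}" and sub: "?A \<subseteq> V"
    and leaf: "\<forall>i\<in>{1..n}. degree E (t i) = 1"
    and steiner: "\<forall>s\<in>V - ?A. degree E s = 3"
    using T by (auto simp: full_steiner_topology_def steiner_topology_def graph_tree_def
        connected_graph_def steiner_points_def)
  have finV: "finite V" using G by (simp add: simple_graph_def)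
  have cardA: "card ?A = n" using inj by (simp add: card_image)
  have cardV: "card V = card (V - ?A) + n"
    using card_Diff_subset[OF finite_subset[OF sub finV] sub] card_mono[OF finV sub]
    unfolding cardA by linarith
  have "2 * card E = (\<Sum>v\<in>V. degree E v)" using sum_degree[OF G] by simp
  also have "\<dots> = (\<Sum>v\<in>V - ?A. degree E v) + (\<Sum>v\<in>?A. degree E v)"
    by (rule sum.subset_diff[OF sub finV])
  also have "(\<Sum>v\<in>V - ?A. degree E v) = 3 * card (V - ?A)" using steiner by simp
  also have "(\<Sum>v\<in>?A. degree E v) = (\<Sum>v\<in>?A. 1)" using leaf by (intro sum.cong) auto
  also have "\<dots> = n" using cardA by simp
  finally have "2 * card E = 3 * card (V - ?A) + n" .
  moreover have "card E < card V" by (rule card_edges_acyclic[OF G acyc \<open>V \<noteq> {}\<close>])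
  ultimately show ?thesis using cardV by linarith
qed

section \<open>Lengths and shortest placements\<close>

lemma edge_length_nonneg:
  assumes "simple_graph V E" "e \<in> E"
  shows "0 \<le> edge_length x e"
proof -
  have "card e = 2" using assms by (auto simp: simple_graph_def)
  then obtain u v where "e = {u, v}" by (auto simp: card_2_iff)
  then show ?thesis by (simp add: edge_length_doubleton)
qed

text \<open>
  The edges of a path without repeated vertices are distinct, and they all lie inside its vertex set.
\<close>

lemma dist_le_path:
  fixes x :: "nat \<Rightarrow> real ^ 'd"
  assumes G: "simple_graph V E"
    and "rtrancl_path (\<lambda>a b. {a, b} \<in> E) u ws v" and "distinct (u # ws)"
  shows "dist (x u) (x v) \<le> (\<Sum>e\<in>{e\<in>E. e \<subseteq> set (u # ws)}. edge_length x e)"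
  using assms(2,3)
proof induction
  case (base u)
  then show ?case by (auto intro!: sum_nonneg edge_length_nonneg[OF G])
next
  case (step u w ws v)
  have finE: "finite E" using G by (rule simple_graph_finite_edges)
  let ?F = "{e\<in>E. e \<subseteq> set (w # ws)}"
  have notin: "{u, w} \<notin> ?F" using step.prems by auto
  have "dist (x u) (x v) \<le> dist (x u) (x w) + dist (x w) (x v)" by (rule dist_triangle)
  also have "\<dots> \<le> edge_length x {u, w} + (\<Sum>e\<in>?F. edge_length x e)"
    using step.IH step.prems by (simp add: edge_length_doubleton)
  also have "\<dots> = (\<Sum>e\<in>insert {u, w} ?F. edge_length x e)"
    using notin finE by simp
  also have "\<dots> \<le> (\<Sum>e\<in>{e\<in>E. e \<subseteq> set (u # w # ws)}. edge_length x e)"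
    using step.hyps finE by (intro sum_mono2) (auto intro: edge_length_nonneg[OF G])
  finally show ?case .
qed

lemma dist_le_tree_length:
  fixes x :: "nat \<Rightarrow> real ^ 'd"
  assumes G: "simple_graph V E" and con: "connected_graph V E" and "u \<in> V" "v \<in> V"
  shows "dist (x u) (x v) \<le> tree_length E x"
proof -
  have "(u, v) \<in> {(a, b). {a, b} \<in> E}\<^sup>*" using con assms(3,4) by (auto simp: connected_graph_def)
  then have "(\<lambda>a b. {a, b} \<in> E)\<^sup>*\<^sup>* u v" by (simp add: rtranclp_rtrancl_eq)
  then obtain ws where "rtrancl_path (\<lambda>a b. {a, b} \<in> E) u ws v" "distinct (u # ws)"
    by (metis rtranclp_eq_rtrancl_path rtrancl_path_distinct)
  from dist_le_path[OF G this]
  have "dist (x u) (x v) \<le> (\<Sum>e\<in>{e\<in>E. e \<subseteq> set (u # ws)}. edge_length x e)" .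
  also have "\<dots> \<le> tree_length E x"
    unfolding tree_length_def using simple_graph_finite_edges[OF G]
    by (intro sum_mono2) (auto intro: edge_length_nonneg[OF G])
  finally show ?thesis .
qed

lemma tree_length_cong:
  assumes "simple_graph V E" "\<And>v. v \<in> V \<Longrightarrow> x v = y v"
  shows "tree_length E x = tree_length E y"
  unfolding tree_length_def edge_length_def
proof (rule sum.cong)
  fix e assume "e \<in> E"
  then have "x ` e = y ` e" using assms by (intro image_cong) (auto simp: simple_graph_def)
  then show "diameter (x ` e) = diameter (y ` e)" by simp
qed simp

lemma continuous_on_tree_length:
  fixes S :: "(nat \<Rightarrow> real ^ 'd) set"
  assumes "simple_graph V E"
  shows "continuous_on S (tree_length E)"
proof -
  have "continuous_on S (\<lambda>x. edge_length x e)" if "e \<in> E" for e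
  proof -
    have "card e = 2" using assms that by (auto simp: simple_graph_def)
    then obtain u v where e: "e = {u, v}" by (auto simp: card_2_iff)
    have "continuous_on S (\<lambda>x :: nat \<Rightarrow> real ^ 'd. x w)" for w
      by (rule continuous_on_product_coordinates[THEN continuous_on_subset]) simp
    then show ?thesis by (simp add: e edge_length_doubleton continuous_on_dist)
  qed
  then have "continuous_on S (\<lambda>x. tree_length E x)"
    unfolding tree_length_def by (intro continuous_on_sum)
  then show ?thesis by simp
qed

text \<open>
  The terminals are given as an arbitrary nonempty set \<open>A\<close> of vertices with fixed positions.
\<close>

lemma ex_shortest_placement:
  fixes x :: "nat \<Rightarrow> real ^ 'd"
  assumes G: "simple_graph V E" and con: "connected_graph V E" and A: "A \<subseteq> V" "a \<in> A"
  shows "\<exists>y. is_arg_min (tree_length E) (\<lambda>y. \<forall>v\<in>A. y v = x v) y"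
proof -
  define B where "B = cball (x a) (tree_length E x)"
  define K where "K = Pi\<^sub>E UNIV (\<lambda>v. if v \<in> A then {x v} else B)"
  have compact: "compact K"
  proof -
    have "compactin (product_topology (\<lambda>_. euclidean) UNIV) K"
      unfolding K_def compactin_PiE by (simp add: B_def)
    then show ?thesis by (simp add: euclidean_product_topology)
  qed
  have aV: "a \<in> V" using A by auto
  have far: "z v \<in> B" if "z a = x a" "v \<in> V" "tree_length E z \<le> tree_length E x" for z v
    using dist_le_tree_length[OF G con aV that(2), of z] that by (simp add: B_def)
  have xaB: "x a \<in> B" using far[of x a] aV by simp
  \<comment> \<open>A placement that agrees with \<open>x\<close> on \<open>A\<close> and is not longer than \<open>x\<close> is moved into \<open>K\<close> by a
    change outside \<open>V\<close>, which does not affect its length.\<close>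
  define into where "into z = (\<lambda>v. if v \<in> V then z v else x a)" for z :: "nat \<Rightarrow> real ^ 'd"
  have len_into: "tree_length E (into z) = tree_length E z" for z
    by (rule tree_length_cong[OF G]) (simp add: into_def)
  have into_K: "into z \<in> K"
    if "\<forall>v\<in>A. z v = x v" "tree_length E z \<le> tree_length E x" for z
    using that far[of z] A xaB by (auto simp: K_def into_def)
  have "into x \<in> K" by (rule into_K) auto
  then have "K \<noteq> {}" by blast
  from continuous_attains_inf[OF compact this continuous_on_tree_length[OF G]]
  obtain y where y: "y \<in> K" and min: "\<And>z. z \<in> K \<Longrightarrow> tree_length E y \<le> tree_length E z"
    by blast
  have "\<forall>v\<in>A. y v = x v" using y by (auto simp: K_def PiE_iff split: if_splits)
  moreover have "tree_length E y \<le> tree_length E z" if z: "\<forall>v\<in>A. z v = x v" for z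
  proof (cases "tree_length E z \<le> tree_length E x")
    case True
    then show ?thesis using min[OF into_K[OF z True]] by (simp add: len_into)
  next
    case False
    then show ?thesis using min[OF \<open>into x \<in> K\<close>] by (simp add: len_into)
  qed
  ultimately have "is_arg_min (tree_length E) (\<lambda>y. \<forall>v\<in>A. y v = x v) y"
    by (auto simp: is_arg_min_linorder)
  then show ?thesis by blast
qed

lemma shortest_tree_terminals:
  fixes x :: "nat \<Rightarrow> real ^ 'd"
  assumes T: "steiner_topology n V E t" and n: "1 \<le> n" and i: "i \<in> {1..n}"
  shows "shortest_tree n E t x (t i) = x (t i)"
proof -
  have G: "simple_graph V E" and con: "connected_graph V E" and A: "t ` {1..n} \<subseteq> V"
    using T by (auto simp: steiner_topology_def graph_tree_def)
  have "t 1 \<in> t ` {1..n}" using n by auto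
  from ex_shortest_placement[OF G con A this, of x]
  have "\<exists>y. is_arg_min (tree_length E) (\<lambda>y. \<forall>i\<in>{1..n}. y (t i) = x (t i)) y"
    by simp
  then have "is_arg_min (tree_length E) (\<lambda>y. \<forall>i\<in>{1..n}. y (t i) = x (t i))
      (shortest_tree n E t x)"
    unfolding shortest_tree_def arg_min_def by (rule someI_ex)
  then show ?thesis using i by (simp add: is_arg_min_def)
qed

section \<open>Walks that do not go backwards\<close>

lemma vec_angle_ge_pi_half:
  assumes "pi / 2 \<le> vec_angle a b"
  shows "a \<bullet> b \<le> 0"
proof (rule ccontr)
  assume "\<not> a \<bullet> b \<le> 0"
  then have pos: "0 < a \<bullet> b" by simp
  then have "0 < norm a * norm b" using norm_cauchy_schwarz[of a b] by linarith
  then have q: "0 < a \<bullet> b / (norm a * norm b)" "a \<bullet> b / (norm a * norm b) \<le> 1"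
    using pos norm_cauchy_schwarz[of a b] by auto
  then have "arccos (a \<bullet> b / (norm a * norm b)) < arccos 0"
    by (intro arccos_less_arccos) auto
  with assms show False by (simp add: vec_angle_def)
qed

text \<open>
  If \<open>b\<close> and \<open>c\<close> both lie strictly behind the line through \<open>0\<close> orthogonal to \<open>d\<close>, they lie strictly
  on opposite sides of the line spanned by \<open>d\<close>.  A nonzero \<open>a\<close> behind or on the former line then
  has a positive inner product with one of them.
\<close>

lemma obtuse_triple_half_plane:
  fixes a b c d :: "real ^ 2"
  assumes ab: "a \<bullet> b \<le> 0" and ac: "a \<bullet> c \<le> 0" and bc: "b \<bullet> c \<le> 0"
    and "a \<noteq> 0" and ad: "a \<bullet> d \<le> 0"
  shows "0 \<le> b \<bullet> d \<or> 0 \<le> c \<bullet> d"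
proof (rule ccontr)
  assume "\<not> ?thesis"
  then have bd: "b \<bullet> d < 0" and cd: "c \<bullet> d < 0" by auto
  \<comment> \<open>\<open>r v\<close> is the inner product of \<open>v\<close> with \<open>d\<close> rotated by a right angle.\<close>
  define r where "r v = v $ 2 * d $ 1 - v $ 1 * d $ 2" for v :: "real ^ 2"
  have decomp: "(v \<bullet> d) * (w \<bullet> d) + r v * r w = (d \<bullet> d) * (v \<bullet> w)" for v w
    by (simp add: inner_vec_def sum_2 r_def algebra_simps)
  have dd: "0 < d \<bullet> d" using bd by auto
  have "(d \<bullet> d) * (v \<bullet> w) \<le> 0" if "v \<bullet> w \<le> 0" for v w :: "real ^ 2"
    using that dd by (simp add: mult_nonneg_nonpos)
  then have bound: "r v * r w \<le> - ((v \<bullet> d) * (w \<bullet> d))" if "v \<bullet> w \<le> 0" for v w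
    using decomp[of v w] that by smt
  have "r b * r c < 0" using bound[OF bc] mult_neg_neg[OF bd cd] by linarith
  moreover have "r a * r b \<le> 0"
    using bound[OF ab] mult_nonpos_nonpos[OF ad less_imp_le[OF bd]] by linarith
  moreover have "r a * r c \<le> 0"
    using bound[OF ac] mult_nonpos_nonpos[OF ad less_imp_le[OF cd]] by linarith
  ultimately have ra: "r a = 0"
    by (smt (verit) mult_less_0_iff mult_pos_pos mult_neg_neg)
  then have "(a \<bullet> d) * (b \<bullet> d) \<le> 0" using bound[OF ab] by simp
  then have "a \<bullet> d = 0" using bd ad by (smt (verit) mult_neg_neg)
  then have "(d \<bullet> d) * (a \<bullet> a) = 0" using decomp[of a a] ra by simp
  then show False using dd \<open>a \<noteq> 0\<close> by simp
qed

lemma ex_terminal_ahead: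
  fixes x :: "nat \<Rightarrow> real ^ 2"
  assumes T: "approx_steiner \<epsilon> n V E t x" and \<epsilon>: "\<epsilon> \<le> pi / 6"
    and e: "{u, v} \<in> E" and ahead: "0 \<le> (x v - x u) \<bullet> d"
  shows "\<exists>i\<in>{1..n}. x v \<bullet> d \<le> x (t i) \<bullet> d"
proof (rule ccontr)
  assume none: "\<not> ?thesis"
  have G: "simple_graph V E" and acyc: "\<nexists>c. graph_cycle E c"
    and deg: "\<forall>s\<in>steiner_points n V t. degree E s = 3"
    using T by (auto simp: approx_steiner_def steiner_topology_def graph_tree_def)
  let ?D = "{(p, q). {p, q} \<in> E \<and> 0 \<le> (x q - x p) \<bullet> d \<and> x v \<bullet> d \<le> x q \<bullet> d}"
  have "?D = {}"
  proof (rule no_endless_continuation[OF G acyc])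
    fix p q assume "(p, q) \<in> ?D"
    then have pq: "{p, q} \<in> E" "0 \<le> (x q - x p) \<bullet> d" "x v \<bullet> d \<le> x q \<bullet> d" by auto
    have "q \<in> V" using edge_ends(3)[OF G pq(1)] .
    then have q: "q \<in> steiner_points n V t"
      using none pq(3) by (auto simp: steiner_points_def)
    then have "card {w. {q, w} \<in> E} = 3" using deg degree_eq_card_neighbours[OF G, of q] by simp
    moreover have qp: "{q, p} \<in> E" using pq(1) by (simp add: insert_commute)
    ultimately have "card ({w. {q, w} \<in> E} - {p}) = 2" by simp
    then obtain w1 w2 where "{w. {q, w} \<in> E} - {p} = {w1, w2}" "w1 \<noteq> w2"
      by (auto simp: card_2_iff)
    then have w: "{q, w1} \<in> E" "{q, w2} \<in> E" "w1 \<noteq> w2" "w1 \<noteq> p" "w2 \<noteq> p" by auto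
    have obtuse: "(x a - x q) \<bullet> (x b - x q) \<le> 0" if "{q, a} \<in> E" "{q, b} \<in> E" "a \<noteq> b" for a b
    proof (rule vec_angle_ge_pi_half)
      have "2 * pi / 3 - \<epsilon> \<le> vec_angle (x a - x q) (x b - x q)"
        using T q that by (auto simp: approx_steiner_def)
      then show "pi / 2 \<le> vec_angle (x a - x q) (x b - x q)" using \<epsilon> by simp
    qed
    have "x p - x q \<noteq> 0" using T q qp by (auto simp: approx_steiner_def)
    moreover have "(x p - x q) \<bullet> d \<le> 0" using pq(2) by (simp add: inner_diff_left)
    ultimately have "0 \<le> (x w1 - x q) \<bullet> d \<or> 0 \<le> (x w2 - x q) \<bullet> d"
      using w qp by (intro obtuse_triple_half_plane[of "x p - x q"] obtuse) auto
    then show "\<exists>w. w \<noteq> p \<and> (q, w) \<in> ?D"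
      using w pq(3) by (auto simp: inner_diff_left)
  qed auto
  moreover have "(u, v) \<in> ?D" using e ahead by simp
  ultimately show False by blast
qed

lemma ex_distant_terminals:
  fixes x :: "nat \<Rightarrow> real ^ 2"
  assumes T: "approx_steiner \<epsilon> n V E t x" and \<epsilon>: "\<epsilon> \<le> pi / 6" and e: "{u, v} \<in> E"
  shows "\<exists>i\<in>{1..n}. \<exists>j\<in>{1..n}. dist (x u) (x v) \<le> dist (x (t i)) (x (t j))"
proof -
  define d where "d = x v - x u"
  obtain i where i: "i \<in> {1..n}" "x v \<bullet> d \<le> x (t i) \<bullet> d"
    using ex_terminal_ahead[OF T \<epsilon> e, of d] by (auto simp: d_def)
  have "{v, u} \<in> E" using e by (simp add: insert_commute)
  moreover have "0 \<le> (x u - x v) \<bullet> (- d)"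
    using inner_ge_zero[of "x u - x v"] by (simp add: d_def)
  ultimately obtain j where j: "j \<in> {1..n}" "x u \<bullet> (- d) \<le> x (t j) \<bullet> (- d)"
    using ex_terminal_ahead[OF T \<epsilon>] by blast
  have "norm d * norm d = x v \<bullet> d - x u \<bullet> d"
    by (simp add: d_def flip: inner_diff_left power2_norm_eq_inner power2_eq_square)
  also have "\<dots> \<le> (x (t i) - x (t j)) \<bullet> d" using i j by (simp add: inner_diff_left)
  also have "\<dots> \<le> norm (x (t i) - x (t j)) * norm d" by (rule norm_cauchy_schwarz)
  finally have "norm d \<le> norm (x (t i) - x (t j))"
    by (smt (verit) mult_le_cancel_right norm_ge_zero)
  then have "dist (x u) (x v) \<le> dist (x (t i)) (x (t j))"
    by (simp add: d_def dist_norm norm_minus_commute)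
  then show ?thesis using i j by blast
qed

section \<open>The bound on the relative excess length\<close>

lemma tree_length_le_shortest:
  fixes x :: "nat \<Rightarrow> real ^ 2"
  assumes full: "full_steiner_topology n V E t" and T: "approx_steiner \<epsilon> n V E t x"
    and \<epsilon>: "\<epsilon> \<le> pi / 6" and n: "1 \<le> n"
  shows "tree_length E x \<le> (2 * real n - 3) * tree_length E (shortest_tree n E t x)"
    and "0 \<le> tree_length E (shortest_tree n E t x)"
proof -
  let ?y = "shortest_tree n E t x"
  have top: "steiner_topology n V E t" using T by (simp add: approx_steiner_def)
  then have G: "simple_graph V E" and con: "connected_graph V E" and sub: "t ` {1..n} \<subseteq> V"
    by (auto simp: steiner_topology_def graph_tree_def)
  show nonneg: "0 \<le> tree_length E ?y"
    unfolding tree_length_def by (intro sum_nonneg edge_length_nonneg[OF G])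
  have "edge_length x e \<le> tree_length E ?y" if e_in: "e \<in> E" for e
  proof -
    have "card e = 2" using G e_in by (auto simp: simple_graph_def)
    then obtain u v where e: "e = {u, v}" by (auto simp: card_2_iff)
    obtain i j where ij: "i \<in> {1..n}" "j \<in> {1..n}"
      and "dist (x u) (x v) \<le> dist (x (t i)) (x (t j))"
      using ex_distant_terminals[OF T \<epsilon>, of u v] e_in e by blast
    moreover have "dist (?y (t i)) (?y (t j)) \<le> tree_length E ?y"
      using sub ij by (intro dist_le_tree_length[OF G con]) auto
    ultimately show ?thesis
      by (simp add: e edge_length_doubleton shortest_tree_terminals[OF top n])
  qed
  then have "tree_length E x \<le> real (card E) * tree_length E ?y"
    unfolding tree_length_def[of E x] by (rule sum_bounded_above)
  also have "\<dots> \<le> (2 * real n - 3) * tree_length E ?y"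
    using card_edges_full_steiner_topology[OF full n] nonneg by (intro mult_right_mono) auto
  finally show "tree_length E x \<le> (2 * real n - 3) * tree_length E ?y" .
qed

theorem proposition6p1:
  fixes \<epsilon> :: real and n :: nat
  assumes "0 \<le> \<epsilon>" and "\<epsilon> \<le> pi / 6" and "n \<ge> 3"
  shows "steiner_F TYPE(2) \<epsilon> n \<le> ereal (2 * real n - 4)"
  unfolding steiner_F_def
proof (rule SUP_least, clarify)
  fix V E t and x :: "nat \<Rightarrow> real ^ 2"
  assume "(V, E, t, x) \<in> approx_full_steiner_trees \<epsilon> n"
  then have full: "full_steiner_topology n V E t" and T: "approx_steiner \<epsilon> n V E t x"
    by (auto simp: approx_full_steiner_trees_def)
  define L where "L = tree_length E x"
  define M where "M = tree_length E (shortest_tree n E t x)"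
  have "1 \<le> n" using assms(3) by simp
  from tree_length_le_shortest[OF full T assms(2) this]
  have le: "L \<le> (2 * real n - 3) * M" and "0 \<le> M" by (auto simp: L_def M_def)
  show "ereal (L - M) / ereal M \<le> ereal (2 * real n - 4)"
  proof (cases "M = 0")
    case True
    \<comment> \<open>Then \<open>T\<close> has length \<open>0\<close> as well, and the quotient is \<open>0 / 0 = 0\<close>.\<close>
    have "0 \<le> L"
      unfolding L_def tree_length_def using T
      by (intro sum_nonneg edge_length_nonneg[of V])
        (auto simp: approx_steiner_def steiner_topology_def graph_tree_def)
    then have "L = 0" using le True by simp
    then show ?thesis using True assms(3) by simp
  next
    case False
    then have "0 < M" using \<open>0 \<le> M\<close> by simp
    then have "(L - M) / M \<le> 2 * real n - 4" using le by (simp add: field_simps)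
    then show ?thesis using False by simp
  qed
qed

end
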